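(* Let $P$ be a Borel probability distribution on $\mathbb{R}^2$ such that every line has $P$-measure zero. Then for all integers $n\ge 3$ and $0\le k\le n-2$, $$E_P(k,n)\le 10\,n\,(k+1)^{1/4}.$$
   Context: A set of at least three points in $\mathbb{R}^2$ is in general position if no three of its points are collinear (and the points are distinct). For a finite set $S\subset\mathbb{R}^2$ in general position, a $k$-facet (also called $k$-edge) of $S$ is a two-element subset $\{x,y\}\subset S$ such that one of the two open halfplanes bounded by the line $\operatorname{aff}(x,y)$ contains exactly $k$ points of $S$. For a Borel probability distribution $P$ on $\mathbb{R}^2$ for which every line has measure zero, a sample of i.i.d. points from $P$ is in general position with probability 1, and $E_P(k,n)$ denotes the expected number of $k$-edges of a set of $n$ i.i.d. random points drawn from $P$. *)

theory Defs
  imports "HOL-Probability.Probability"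
begin

text \<open>Replacing \<open>(a, b)\<close> by \<open>(- a, - b)\<close> exchanges the two sides, so for a line \<open>L\<close>
  this set consists of exactly the two open halfplanes bounded by \<open>L\<close>.\<close>

definition open_halfplanes :: "(real^2) set \<Rightarrow> (real^2) set set" where
  "open_halfplanes L =
     {H. \<exists>a b. a \<noteq> 0 \<and> L = {z. a \<bullet> z = b} \<and> H = {z. a \<bullet> z < b}}"

text \<open>A \<open>k\<close>-edge is an unordered pair, so it is counted once even if both halfplanes contain
  exactly \<open>k\<close> points. The notion is intended for finite \<open>S\<close> in general position, which the
  definition does not require.\<close>

definition k_edges :: "nat \<Rightarrow> (real^2) set \<Rightarrow> (real^2) set set" where
  "k_edges k S =
     {{x, y} | x y. x \<in> S \<and> y \<in> S \<and> x \<noteq> y \<and>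
        (\<exists>H \<in> open_halfplanes (affine hull {x, y}). card (S \<inter> H) = k)}"

text \<open>The \<open>n\<close> i.i.d. points are the coordinates of the \<open>n\<close>-fold product of \<open>P\<close>. If lines are
  \<open>P\<close>-null, samples not in general position form a null set and do not affect the integral.
  The integrand is bounded and Borel (its level sets are given by finitely many polynomial
  equations and inequalities in the coordinates), so the Bochner integral is not a default value.\<close>

definition expected_k_edges :: "(real^2) measure \<Rightarrow> nat \<Rightarrow> nat \<Rightarrow> real" where
  "expected_k_edges P k n =
     (\<integral>\<omega>. real (card (k_edges k (\<omega> ` {..<n}))) \<partial>(Pi\<^sub>M {..<n} (\<lambda>_. P)))"

end

theory Submission
  imports Defs
begin

text \<open>The proof follows Barany and Steiger. Cut the plane by \<open>s - 1\<close> vertical lines into strips of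
equal probability \<open>1 / s\<close>, and put \<open>K = min k (n - 2 - k)\<close>; in general position a \<open>k\<close>-edge has exactly \<open>K\<close>
points above it or exactly \<open>K\<close> points below it. There are two kinds of such edges.

An edge that crosses one of the vertical lines is controlled deterministically, by Lovasz's lemma:
a vertical line is crossed by at most \<open>K + 1\<close> edges with exactly \<open>K\<close> points above
(\<open>card_crossing_pairs_le\<close>), and likewise for below. The proof given here needs no continuous motion
of a line: the number of points that lie above the edge and to the right of the vertical line
strictly decreases with the slope of the edge, and it is one of \<open>0, \<dots>, K\<close>.

An edge within a strip is controlled by probability. A given ordered pair of sample points, the first to
the left of the second, lies in one strip with probability at most \<open>1 / s\<close>. Given the two points, the number
of other points above their line is binomial with \<open>n - 2\<close> trials, and as \<open>2 * K \<le> n - 2\<close>, no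
success probability gives the value \<open>K\<close> a chance greater than \<open>4 / sqrt (K + 1)\<close>
(\<open>binomial_pmf_le\<close>, \<open>prob_pair_and_card_le\<close>).

Altogether the expectation is at most \<open>2 * ((s - 1) * (K + 1) + n\<^sup>2 * 4 / (s * sqrt (K + 1)))\<close>, and
\<open>s = \<lceil>n / (K + 1) powr (3 / 4)\<rceil>\<close> gives \<open>10 * n * (K + 1) powr (1 / 4)\<close>. Samples that are not in general
position form a null set (\<open>AE_general_position\<close>). The number of \<open>k\<close>-edges is compared almost everywhere
with an integrable function, which bounds its integral.\<close>

section \<open>Edges crossing a vertical line\<close>

text \<open>Let \<open>(m, c)\<close> stand for the line of slope \<open>m\<close> that has height \<open>c\<close> above \<open>t\<close>.
Pass from one line to another of at least the same slope with the same number of points above it. If the height at \<open>t\<close>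
does not drop, the new line lies on or above the old one to the right of \<open>t\<close>, so points
above can only be lost there, and the point \<open>j\<close> on the new line is lost. If the height
drops, the new line lies below the old one to the left of \<open>t\<close>, so points above are gained
there (among them the point \<open>i\<close> of the old line), and the constant total forces a loss on the
right.\<close>

lemma right_count_less:
  fixes x y :: "'i \<Rightarrow> real"
  assumes fin: "finite I" and slope: "m \<le> m'" and diff: "(m, c) \<noteq> (m', c')"
    and above: "card {l \<in> I. c + m * (x l - t) < y l} = k"
    and above': "card {l \<in> I. c' + m' * (x l - t) < y l} = k"
    and i: "i \<in> I" "x i < t" "y i = c + m * (x i - t)"
    and j: "j \<in> I" "t < x j" "y j = c' + m' * (x j - t)"
  shows "card {l \<in> I. t \<le> x l \<and> c' + m' * (x l - t) < y l}
       < card {l \<in> I. t \<le> x l \<and> c + m * (x l - t) < y l}"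
    (is "card ?R' < card ?R")
proof (cases "c \<le> c'")
  case True
  have "?R' \<subseteq> ?R"
  proof
    fix l assume "l \<in> ?R'"
    moreover from this have "m * (x l - t) \<le> m' * (x l - t)"
      using slope by (intro mult_right_mono) auto
    ultimately show "l \<in> ?R" using True by auto
  qed
  moreover have "j \<in> ?R"
  proof (cases "c < c'")
    case True
    have "m * (x j - t) \<le> m' * (x j - t)" using slope j by (intro mult_right_mono) auto
    with True j(2,3) have "t \<le> x j \<and> c + m * (x j - t) < y j" by linarith
    with j(1) show ?thesis by blast
  next
    case False
    hence "m < m'" "c = c'" using True slope diff by auto
    hence "m * (x j - t) < m' * (x j - t)" using j by (intro mult_strict_right_mono) auto
    with \<open>c = c'\<close> j(2,3) have "t \<le> x j \<and> c + m * (x j - t) < y j" by linarith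
    with j(1) show ?thesis by blast
  qed
  moreover have "j \<notin> ?R'" using j by simp
  ultimately have "?R' \<subset> ?R" by blast
  thus ?thesis using fin by (intro psubset_card_mono) auto
next
  case False
  let ?L = "{l \<in> I. x l < t \<and> c + m * (x l - t) < y l}"
  let ?L' = "{l \<in> I. x l < t \<and> c' + m' * (x l - t) < y l}"
  have lt: "c' + m' * (x l - t) < c + m * (x l - t)" if "x l < t" for l
  proof -
    have "m' * (x l - t) \<le> m * (x l - t)" using slope that by (intro mult_right_mono_neg) auto
    thus ?thesis using False by simp
  qed
  have "?L \<subseteq> ?L'" using lt by fastforce
  moreover have "i \<in> ?L'" "i \<notin> ?L" using i lt[of i] by auto
  ultimately have "?L \<subset> ?L'" by blast
  hence *: "card ?L < card ?L'" using fin by (intro psubset_card_mono) auto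
  have "card (?L \<union> ?R) = card ?L + card ?R" "card (?L' \<union> ?R') = card ?L' + card ?R'"
    using fin by (intro card_Un_disjoint; force)+
  moreover have "?L \<union> ?R = {l \<in> I. c + m * (x l - t) < y l}"
    "?L' \<union> ?R' = {l \<in> I. c' + m' * (x l - t) < y l}" by auto
  ultimately show ?thesis using * above above' by simp
qed

text \<open>Lovasz's lemma, for one side of the lines: the number of points to the right of \<open>t\<close> and above the
line is at most \<open>k\<close>, and by the preceding lemma it distinguishes any two different lines.
General position then recovers the pair of points from the line.\<close>

lemma card_crossing_pairs_le:
  fixes x y :: "'i \<Rightarrow> real"
  assumes fin: "finite I"
    and gp: "\<And>i j l. \<lbrakk>i \<in> I; j \<in> I; l \<in> I; x i < x j; l \<noteq> i; l \<noteq> j\<rbrakk> \<Longrightarrow>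
               (x j - x i) * (y l - y i) - (y j - y i) * (x l - x i) \<noteq> 0"
  shows "card {(i, j) \<in> I \<times> I. x i < t \<and> t < x j \<and>
           card {l \<in> I. 0 < (x j - x i) * (y l - y i) - (y j - y i) * (x l - x i)} = k} \<le> k + 1"
    (is "card ?C \<le> _")
proof -
  define m where "m = (\<lambda>(i, j). (y j - y i) / (x j - x i))"
  define c where "c = (\<lambda>(i, j). y i + m (i, j) * (t - x i))"
  define R where "R q = {l \<in> I. t \<le> x l \<and> c q + m q * (x l - t) < y l}" for q
  have line: "0 < (x j - x i) * (y l - y i) - (y j - y i) * (x l - x i) \<longleftrightarrow>
                c (i, j) + m (i, j) * (x l - t) < y l"
       "(x j - x i) * (y l - y i) - (y j - y i) * (x l - x i) = 0 \<longleftrightarrow>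
                y l = c (i, j) + m (i, j) * (x l - t)"
    if "x i < x j" for i j l
  proof -
    have "(x j - x i) * (y l - (c (i, j) + m (i, j) * (x l - t))) =
            (x j - x i) * (y l - y i) - (x j - x i) * m (i, j) * (x l - x i)"
      unfolding c_def by (simp add: algebra_simps)
    also have "(x j - x i) * m (i, j) = y j - y i" using that by (simp add: m_def)
    finally have eq: "(x j - x i) * (y l - y i) - (y j - y i) * (x l - x i) =
        (x j - x i) * (y l - (c (i, j) + m (i, j) * (x l - t)))" by simp
    show "0 < (x j - x i) * (y l - y i) - (y j - y i) * (x l - x i) \<longleftrightarrow>
                c (i, j) + m (i, j) * (x l - t) < y l"
      unfolding eq using that by (simp add: zero_less_mult_iff)
    show "(x j - x i) * (y l - y i) - (y j - y i) * (x l - x i) = 0 \<longleftrightarrow>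
                y l = c (i, j) + m (i, j) * (x l - t)"
      unfolding eq using that by auto
  qed
  have C: "i \<in> I" "j \<in> I" "x i < t" "t < x j"
      "card {l \<in> I. c (i, j) + m (i, j) * (x l - t) < y l} = k"
      "y i = c (i, j) + m (i, j) * (x i - t)" "y j = c (i, j) + m (i, j) * (x j - t)"
    if "(i, j) \<in> ?C" for i j
  proof -
    show *: "i \<in> I" "j \<in> I" "x i < t" "t < x j" using that by auto
    hence lt: "x i < x j" by simp
    show "card {l \<in> I. c (i, j) + m (i, j) * (x l - t) < y l} = k"
      using that line(1)[OF lt] by simp
    show "y i = c (i, j) + m (i, j) * (x i - t)" "y j = c (i, j) + m (i, j) * (x j - t)"
      using line(2)[OF lt, of i] line(2)[OF lt, of j] by simp_all
  qed
  have less: "card (R q') < card (R q)"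
    if "q \<in> ?C" "q' \<in> ?C" "m q \<le> m q'" "(m q, c q) \<noteq> (m q', c q')" for q q'
  proof -
    obtain i j i' j' where q: "q = (i, j)" "q' = (i', j')" by (cases q, cases q')
    note Cq = C[OF that(1)[unfolded q(1)]] and Cq' = C[OF that(2)[unfolded q(2)]]
    show ?thesis unfolding R_def q
      using that(3,4) Cq Cq' unfolding q
      by (intro right_count_less[OF fin _ _ Cq(5) Cq'(5) Cq(1,3,6) Cq'(2,4,7)]) auto
  qed
  have "inj_on (\<lambda>q. card (R q)) ?C"
  proof (rule inj_onI)
    fix q q' assume q: "q \<in> ?C" "q' \<in> ?C" and eq: "card (R q) = card (R q')"
    have same: "(m q, c q) = (m q', c q')"
      using less[OF q] less[OF q(2,1)] eq by (metis linear order_less_irrefl)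
    obtain i j i' j' where ij: "q = (i, j)" "q' = (i', j')" by (cases q, cases q')
    note Cq = C[OF q(1)[unfolded ij(1)]] and Cq' = C[OF q(2)[unfolded ij(2)]]
    have lt: "x i < x j" using Cq by simp
    have "i' \<in> {i, j}" using gp[OF Cq(1,2) Cq'(1) lt] line(2)[OF lt, of i'] Cq'(6) same ij by auto
    moreover have "j' \<in> {i, j}"
      using gp[OF Cq(1,2) Cq'(2) lt] line(2)[OF lt, of j'] Cq'(7) same ij by auto
    ultimately show "q = q'" using Cq(3,4) Cq'(3,4) ij by auto
  qed
  moreover have "(\<lambda>q. card (R q)) ` ?C \<subseteq> {..k}"
  proof
    fix r assume "r \<in> (\<lambda>q. card (R q)) ` ?C"
    then obtain i j where q: "(i, j) \<in> ?C" "r = card (R (i, j))" by (metis (no_types, lifting) imageE surj_pair)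
    have "card (R (i, j)) \<le> card {l \<in> I. c (i, j) + m (i, j) * (x l - t) < y l}"
      unfolding R_def using fin by (intro card_mono) auto
    thus "r \<in> {..k}" using C(5)[OF q(1)] q(2) by simp
  qed
  ultimately have "card ?C \<le> card {..k}" by (rule card_inj_on_le) simp
  thus ?thesis by simp
qed

section \<open>Orientation of triples in the plane\<close>

text \<open>This is twice the signed area of the triangle \<open>p q r\<close>. If \<open>p\<close> lies to the left of \<open>q\<close>, it is positive
exactly when \<open>r\<close> lies above the line through \<open>p\<close> and \<open>q\<close>.\<close>

definition orient :: "real^2 \<Rightarrow> real^2 \<Rightarrow> real^2 \<Rightarrow> real" where
  "orient p q r = (q$1 - p$1) * (r$2 - p$2) - (q$2 - p$2) * (r$1 - p$1)"

lemma orient_degenerate [simp]: "orient p q p = 0" "orient p q q = 0"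
  by (simp_all add: orient_def algebra_simps)

lemma measurable_vec_nth_2 [measurable]: "(\<lambda>z :: real^2. z $ i) \<in> borel_measurable borel"
  by (intro borel_measurable_continuous_onI continuous_intros)

lemma orient_measurable [measurable]:
  assumes [measurable]: "f \<in> borel_measurable M" "g \<in> borel_measurable M" "h \<in> borel_measurable M"
  shows "(\<lambda>w. orient (f w) (g w) (h w)) \<in> borel_measurable M"
  unfolding orient_def by measurable

lemma orient_eq_0_imp_affine_hull:
  assumes "orient p q z = 0" "p \<noteq> q"
  shows "z \<in> affine hull {p, q}"
proof -
  obtain i :: 2 where i: "p $ i \<noteq> q $ i" using assms(2) by (metis vec_eq_iff)
  define v where "v = (z $ i - p $ i) / (q $ i - p $ i)"
  have v: "z $ i - p $ i = v * (q $ i - p $ i)" using i by (simp add: v_def)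
  have "z = (1 - v) *\<^sub>R p + v *\<^sub>R q"
  proof (subst vec_eq_iff, rule allI)
    fix k :: 2
    have "(q $ i - p $ i) * (z $ k - p $ k) = (q $ k - p $ k) * (z $ i - p $ i)"
      using assms(1) exhaust_2[of i] exhaust_2[of k] by (auto simp: orient_def algebra_simps)
    also have "\<dots> = (q $ i - p $ i) * (v * (q $ k - p $ k))" using v by simp
    finally have "z $ k - p $ k = v * (q $ k - p $ k)" using i by simp
    thus "z $ k = ((1 - v) *\<^sub>R p + v *\<^sub>R q) $ k" by (simp add: algebra_simps)
  qed
  thus ?thesis unfolding affine_hull_2 by force
qed

lemma open_halfplanes_affine_hull_2:
  assumes H: "H \<in> open_halfplanes (affine hull {p, q})" and pq: "p $ 1 < q $ 1"
  shows "\<exists>e\<in>{1, -1}. H = {z. 0 < e * orient p q z}"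
proof -
  from H obtain a b where a: "a \<noteq> 0" "affine hull {p, q} = {z. a \<bullet> z = b}" "H = {z. a \<bullet> z < b}"
    unfolding open_halfplanes_def by blast
  have "p \<in> affine hull {p, q}" "q \<in> affine hull {p, q}" by (simp_all add: hull_inc)
  hence ap: "a $ 1 * p $ 1 + a $ 2 * p $ 2 = b" and aq: "a $ 1 * q $ 1 + a $ 2 * q $ 2 = b"
    using a(2) by (auto simp: inner_vec_def sum_2)
  have "a $ 2 \<noteq> 0"
  proof
    assume 0: "a $ 2 = 0"
    hence "a $ 1 * (q $ 1 - p $ 1) = 0" using ap aq by (simp add: algebra_simps)
    hence "a $ 1 = 0" using pq by simp
    thus False using 0 a(1) by (metis exhaust_2 vec_eq_iff zero_index)
  qed
  \<comment> \<open>The normal vector of the line is a multiple of \<open>(p $ 2 - q $ 2, q $ 1 - p $ 1)\<close>.\<close>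
  have key: "(q $ 1 - p $ 1) * (a \<bullet> z - b) = a $ 2 * orient p q z" for z
  proof -
    have "(q $ 1 - p $ 1) * (a \<bullet> z - b) = (q $ 1 - p $ 1) * (a $ 1 * (z $ 1 - p $ 1) + a $ 2 * (z $ 2 - p $ 2))"
      unfolding ap[symmetric] by (simp add: inner_vec_def sum_2 algebra_simps)
    also have "\<dots> = (a $ 1 * (q $ 1 - p $ 1)) * (z $ 1 - p $ 1) + a $ 2 * (q $ 1 - p $ 1) * (z $ 2 - p $ 2)"
      by (simp add: algebra_simps)
    also have "a $ 1 * (q $ 1 - p $ 1) = - (a $ 2 * (q $ 2 - p $ 2))"
      using ap aq by (simp add: algebra_simps)
    finally show ?thesis by (simp add: orient_def algebra_simps)
  qed
  have "a \<bullet> z < b \<longleftrightarrow> a $ 2 * orient p q z < 0" for z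
    unfolding key[symmetric] using pq by (simp add: mult_less_0_iff)
  thus ?thesis using \<open>a $ 2 \<noteq> 0\<close> a(3) by (cases "a $ 2 < 0") (auto simp: mult_less_0_iff)
qed

section \<open>Counting k-edges by strips\<close>

text \<open>A halfplane of a \<open>k\<close>-edge is the upper (\<open>e = 1\<close>) or the lower (\<open>e = -1\<close>) one, and the two
halfplanes together contain \<open>n - 2\<close> points. So \<open>k\<close>-edges are also \<open>(n - 2 - k)\<close>-edges, and one may
count with the smaller of the two numbers.\<close>

lemma card_k_edges_le:
  fixes p :: "nat \<Rightarrow> real^2"
  assumes xs: "\<And>i j. \<lbrakk>i < n; j < n; i \<noteq> j\<rbrakk> \<Longrightarrow> p i $ 1 \<noteq> p j $ 1"
    and gp: "\<And>i j l. \<lbrakk>i < n; j < n; l < n; i \<noteq> j; l \<noteq> i; l \<noteq> j\<rbrakk> \<Longrightarrow> orient (p i) (p j) (p l) \<noteq> 0"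
    and k: "k \<le> n - 2" "K = k \<or> K = n - 2 - k"
  shows "card (k_edges k (p ` {..<n})) \<le>
           (\<Sum>e\<in>{1, -1}. card {(i, j) \<in> {..<n} \<times> {..<n}. p i $ 1 < p j $ 1 \<and>
              card {l \<in> {..<n}. 0 < e * orient (p i) (p j) (p l)} = K})"
proof -
  define U where "U e = {(i, j) \<in> {..<n} \<times> {..<n}. p i $ 1 < p j $ 1 \<and>
              card {l \<in> {..<n}. 0 < e * orient (p i) (p j) (p l)} = K}" for e :: real
  have inj: "inj_on p {..<n}"
    using xs by (intro inj_onI) (metis lessThan_iff)
  have finU: "finite (U e)" for e
    unfolding U_def by (rule finite_subset[of _ "{..<n} \<times> {..<n}"]) auto
  have cards: "card {l \<in> {..<n}. 0 < 1 * orient (p i) (p j) (p l)}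
             + card {l \<in> {..<n}. 0 < - 1 * orient (p i) (p j) (p l)} = n - 2"
    if ij: "i < n" "j < n" "i \<noteq> j" for i j
  proof -
    let ?A = "{l \<in> {..<n}. 0 < 1 * orient (p i) (p j) (p l)}"
    let ?B = "{l \<in> {..<n}. 0 < - 1 * orient (p i) (p j) (p l)}"
    have "l \<in> ?A \<union> ?B \<longleftrightarrow> l \<in> {..<n} - {i, j}" for l
      using gp[OF ij(1,2) _ ij(3), of l] by (cases "l = i \<or> l = j") auto
    hence "?A \<union> ?B = {..<n} - {i, j}" by blast
    moreover have "card (?A \<union> ?B) = card ?A + card ?B" by (intro card_Un_disjoint) auto
    moreover have "card ({..<n} - {i, j}) = n - 2" using ij by (subst card_Diff_subset) auto
    ultimately show ?thesis by simp
  qed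
  have "k_edges k (p ` {..<n}) \<subseteq> (\<lambda>(i, j). {p i, p j}) ` (U 1 \<union> U (-1))"
  proof
    fix E assume "E \<in> k_edges k (p ` {..<n})"
    then obtain i' j' H where E': "E = {p i', p j'}" "i' < n" "j' < n" "p i' \<noteq> p j'"
        "H \<in> open_halfplanes (affine hull {p i', p j'})" "card (p ` {..<n} \<inter> H) = k"
      unfolding k_edges_def by blast
    obtain i j where E: "E = {p i, p j}" "i < n" "j < n" "p i $ 1 < p j $ 1"
        "H \<in> open_halfplanes (affine hull {p i, p j})"
    proof (cases "p i' $ 1 < p j' $ 1")
      case True
      thus ?thesis using that[of i' j'] E' by blast
    next
      case False
      hence "p j' $ 1 < p i' $ 1" using xs[of i' j'] E' by force
      thus ?thesis using that[of j' i'] E' by (simp add: insert_commute)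
    qed
    have "i \<noteq> j" using E(4) by auto
    obtain e :: real where e: "e \<in> {1, -1}" "H = {z. 0 < e * orient (p i) (p j) z}"
      using open_halfplanes_affine_hull_2[OF E(5,4)] by blast
    have "p ` {..<n} \<inter> H = p ` {l \<in> {..<n}. 0 < e * orient (p i) (p j) (p l)}"
      unfolding e(2) by auto
    moreover have "inj_on p {l \<in> {..<n}. 0 < e * orient (p i) (p j) (p l)}"
      by (rule inj_on_subset[OF inj]) auto
    ultimately have ck: "card {l \<in> {..<n}. 0 < e * orient (p i) (p j) (p l)} = k"
      using E'(6) by (simp only: card_image)
    have "\<exists>e'\<in>{1, -1 :: real}. card {l \<in> {..<n}. 0 < e' * orient (p i) (p j) (p l)} = K"
      using k(2)
    proof
      assume "K = k"
      thus ?thesis using ck e(1) by blast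
    next
      assume K: "K = n - 2 - k"
      hence "card {l \<in> {..<n}. 0 < (- e) * orient (p i) (p j) (p l)} = K"
        using cards[OF E(2,3) \<open>i \<noteq> j\<close>] ck e(1) k(1) by auto
      thus ?thesis using e(1) by (intro bexI[of _ "- e"]) auto
    qed
    hence "(i, j) \<in> U 1 \<union> U (-1)" using E unfolding U_def by blast
    thus "E \<in> (\<lambda>(i, j). {p i, p j}) ` (U 1 \<union> U (-1))" using E(1) by force
  qed
  hence "card (k_edges k (p ` {..<n})) \<le> card (U 1 \<union> U (-1))"
    using finU by (intro surj_card_le) auto
  also have "\<dots> \<le> card (U 1) + card (U (-1))" by (rule card_Un_le)
  also have "\<dots> = (\<Sum>e\<in>{1, -1}. card (U e))" by simp
  finally show ?thesis unfolding U_def .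
qed

text \<open>The vertical lines over \<open>T\<close> cut the plane into strips. A pair either lies in one (closed) strip or
crosses one of these lines, and each line is crossed by at most \<open>K + 1\<close> pairs. The factor \<open>e\<close> is
absorbed by a rescaling of the second coordinate, a reflection for the lower halfplanes.\<close>

lemma card_pairs_le_strips:
  fixes p :: "nat \<Rightarrow> real^2" and e :: real
  assumes gp: "\<And>i j l. \<lbrakk>i < n; j < n; l < n; i \<noteq> j; l \<noteq> i; l \<noteq> j\<rbrakk> \<Longrightarrow> orient (p i) (p j) (p l) \<noteq> 0"
    and e: "e \<noteq> 0" and T: "finite T"
  shows "card {(i, j) \<in> {..<n} \<times> {..<n}. p i $ 1 < p j $ 1 \<and>
              card {l \<in> {..<n}. 0 < e * orient (p i) (p j) (p l)} = K}
         \<le> card {(i, j) \<in> {..<n} \<times> {..<n}. (p i $ 1 < p j $ 1 \<and> (\<forall>t\<in>T. \<not> (p i $ 1 < t \<and> t < p j $ 1))) \<and>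
              card {l \<in> {..<n}. 0 < e * orient (p i) (p j) (p l)} = K} + card T * (K + 1)"
    (is "card ?A \<le> card ?B + _")
proof -
  define C where "C t = {(i, j) \<in> {..<n} \<times> {..<n}. p i $ 1 < t \<and> t < p j $ 1 \<and>
              card {l \<in> {..<n}. 0 < e * orient (p i) (p j) (p l)} = K}" for t
  have eq: "(p j $ 1 - p i $ 1) * (e * p l $ 2 - e * p i $ 2) - (e * p j $ 2 - e * p i $ 2) * (p l $ 1 - p i $ 1)
      = e * orient (p i) (p j) (p l)" for i j l
    by (simp add: orient_def algebra_simps)
  have C: "card (C t) \<le> K + 1" for t
    unfolding C_def
  proof (rule card_crossing_pairs_le[of "{..<n}" "\<lambda>i. p i $ 1" "\<lambda>i. e * p i $ 2" t K, unfolded eq])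
    fix i j l assume "i \<in> {..<n}" "j \<in> {..<n}" "l \<in> {..<n}" "p i $ 1 < p j $ 1" "l \<noteq> i" "l \<noteq> j"
    thus "e * orient (p i) (p j) (p l) \<noteq> 0" using gp[of i j l] e by auto
  qed simp
  have fin: "finite ?B" "finite (\<Union>t\<in>T. C t)"
    unfolding C_def by (rule finite_subset[of _ "{..<n} \<times> {..<n}"]; auto)+
  have "?A \<subseteq> ?B \<union> (\<Union>t\<in>T. C t)" unfolding C_def by auto
  hence "card ?A \<le> card (?B \<union> (\<Union>t\<in>T. C t))" using fin by (intro card_mono) auto
  also have "\<dots> \<le> card ?B + card (\<Union>t\<in>T. C t)" by (rule card_Un_le)
  also have "card (\<Union>t\<in>T. C t) \<le> (\<Sum>t\<in>T. card (C t))" using T by (rule card_UN_le)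
  also have "(\<Sum>t\<in>T. card (C t)) \<le> card T * (K + 1)"
    using sum_bounded_above[of T "\<lambda>t. card (C t)" "K + 1"] C by simp
  finally show ?thesis by simp
qed

section \<open>Binomial probabilities\<close>

lemma prod3_ge:
  fixes a b c :: real
  assumes "0 \<le> a" "a \<le> 1" "0 \<le> b" "b \<le> 1" "0 \<le> c" "c \<le> 1"
  shows "1 - a - b - c \<le> (1 - a) * ((1 - b) * (1 - c))"
proof -
  have "1 - b - c \<le> (1 - b) * (1 - c)" using assms by (simp add: algebra_simps)
  hence "(1 - a) * (1 - b - c) \<le> (1 - a) * ((1 - b) * (1 - c))"
    using assms by (intro mult_left_mono) auto
  moreover have "0 \<le> a * b" "0 \<le> a * c" using assms by simp_all
  ultimately show ?thesis by (simp add: algebra_simps)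
qed

text \<open>Multiplying the factors of the first \<open>i\<close> steps gives \<open>1 - \<Sum>j<i. (2 * j + 1) / K\<close> at least, which is
\<open>1 - i\<^sup>2 / K\<close>. A sequence of this kind therefore keeps half of its initial value for about
\<open>sqrt (K / 2)\<close> steps.\<close>

lemma slow_decay:
  fixes g :: "nat \<Rightarrow> real" and K :: nat
  assumes g: "0 \<le> g 0"
    and step: "\<And>i. i < K \<Longrightarrow> (1 - i / K) * (1 - (real i + 1) / K) * g i \<le> g (Suc i)"
    and i: "i\<^sup>2 \<le> K"
  shows "(1 - (real i)\<^sup>2 / K) * g 0 \<le> g i"
  using i
proof (induction i)
  case 0
  then show ?case by simp
next
  case (Suc i)
  have K: "i\<^sup>2 \<le> K" "i < K" "0 < K" "i + 1 \<le> K"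
    using Suc.prems by (auto simp: power2_eq_square)
  have r: "0 \<le> real i / K" "real i / K \<le> 1" "0 \<le> (real i + 1) / K" "(real i + 1) / K \<le> 1"
       "0 \<le> (real i)\<^sup>2 / K" "(real i)\<^sup>2 / K \<le> 1"
    using K by (auto simp: divide_le_eq_1 simp flip: of_nat_power)
  have "1 - (real (Suc i))\<^sup>2 / K = 1 - (real i)\<^sup>2 / K - i / K - (real i + 1) / K"
    by (simp add: power2_eq_square add_divide_distrib algebra_simps)
  also have "\<dots> \<le> (1 - (real i)\<^sup>2 / K) * ((1 - i / K) * (1 - (real i + 1) / K))"
    using r by (intro prod3_ge) auto
  finally have "(1 - (real (Suc i))\<^sup>2 / K) * g 0
      \<le> (1 - (real i)\<^sup>2 / K) * ((1 - i / K) * (1 - (real i + 1) / K)) * g 0"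
    using g by (intro mult_right_mono)
  also have "\<dots> = (1 - i / K) * (1 - (real i + 1) / K) * ((1 - (real i)\<^sup>2 / K) * g 0)"
    by (simp add: ac_simps)
  also have "\<dots> \<le> (1 - i / K) * (1 - (real i + 1) / K) * g i"
    using r Suc.IH K by (intro mult_left_mono mult_nonneg_nonneg) auto
  also have "\<dots> \<le> g (Suc i)" using K by (intro step)
  finally show ?case .
qed

lemma binomial_pmf_Suc:
  fixes p :: real
  assumes "j < m"
  shows "(real j + 1) * (1 - p) * ((m choose Suc j) * p ^ Suc j * (1 - p) ^ (m - Suc j))
       = (real m - real j) * p * ((m choose j) * p ^ j * (1 - p) ^ (m - j))"
proof -
  have "Suc j * (m choose Suc j) = (m - j) * (m choose j)"
    by (simp only: binomial_absorption binomial_absorb_comp)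
  hence "real (Suc j * (m choose Suc j)) = real ((m - j) * (m choose j))" by (rule arg_cong)
  hence eq: "(real j + 1) * (m choose Suc j) = (real m - real j) * (m choose j)"
    using assms by (simp only: of_nat_mult of_nat_Suc of_nat_diff less_imp_le add.commute)
  have "(1 - p) ^ (m - j) = (1 - p) * (1 - p) ^ (m - Suc j)"
    using assms by (metis Suc_diff_Suc power_Suc)
  hence "(real j + 1) * (1 - p) * ((m choose Suc j) * p ^ Suc j * (1 - p) ^ (m - Suc j))
      = ((real j + 1) * (m choose Suc j)) * p * (p ^ j * (1 - p) ^ (m - j))"
    by (simp only: power_Suc ac_simps)
  thus ?thesis unfolding eq by (simp only: ac_simps)
qed

text \<open>Close to \<open>K\<close> the binomial probabilities fall by at most a constant factor over about \<open>sqrt K\<close>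
steps in the direction of the mean. Walking from \<open>K\<close> towards the mean, about
\<open>sqrt (K / 2)\<close> values have at least half the probability of \<open>K\<close>, while all probabilities add up to 1.\<close>

lemma binomial_pmf_le:
  fixes p :: real
  assumes K: "2 * K \<le> m" and p: "0 \<le> p" "p \<le> 1"
  shows "(m choose K) * p ^ K * (1 - p) ^ (m - K) \<le> 4 / sqrt (real K + 1)"
proof -
  define f where "f j = (m choose j) * p ^ j * (1 - p) ^ (m - j)" for j
  have f0: "0 \<le> f j" for j using p by (simp add: f_def)
  have "(\<Sum>j\<le>m. f j) = (p + (1 - p)) ^ m" unfolding f_def by (rule binomial_ring[symmetric])
  hence f1: "(\<Sum>j\<le>m. f j) = 1" by simp
  have Suc: "(real j + 1) * (1 - p) * f (Suc j) = (real m - real j) * p * f j" if "j < m" for j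
    unfolding f_def using binomial_pmf_Suc[OF that] by simp
  show ?thesis
  proof (cases "K = 0 \<or> p = 0 \<or> p = 1")
    case True
    have "f K \<le> (\<Sum>j\<le>m. f j)" using K f0 by (intro member_le_sum) auto
    moreover have "f K = 0" if "K \<noteq> 0" using that True K by (auto simp: f_def)
    ultimately have "f K \<le> 4 / sqrt (real K + 1)" using f1 by (cases "K = 0") auto
    thus ?thesis unfolding f_def .
  next
    case False
    hence K0: "0 < K" and p0: "0 < p" "p < 1" using p by auto
    have KK: "real K \<le> real m - real K" "0 < real K" using K K0 by auto
    \<comment> \<open>The walk goes up if the mean \<open>m * p\<close> is at least \<open>K\<close>, and down otherwise.\<close>
    have mode: "\<exists>h. inj_on h {i. i\<^sup>2 \<le> K} \<and> h ` {i. i\<^sup>2 \<le> K} \<subseteq> {..m} \<and>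
        (\<forall>i. i\<^sup>2 \<le> K \<longrightarrow> (1 - (real i)\<^sup>2 / K) * f K \<le> f (h i))"
    proof (cases "real K \<le> real m * p")
      case True
      have "(1 - (real i)\<^sup>2 / K) * f (K + 0) \<le> f (K + i)" if "i\<^sup>2 \<le> K" for i
      proof (rule slow_decay[OF _ _ that])
        fix i assume i: "i < K"
        hence im: "K + i < m" using K by linarith
        have "(1 - i / K) * (1 - (real i + 1) / K) * ((real (K + i) + 1) * (1 - p)) \<le> (real m - real (K + i)) * p"
        proof -
          have "(1 - (real i + 1) / K) * (real (K + i) + 1) \<le> K"
            using K0 by (simp add: field_simps)
          hence "(1 - i / K) * (1 - p) * ((1 - (real i + 1) / K) * (real (K + i) + 1)) \<le> (1 - i / K) * (1 - p) * K"
            using i p by (intro mult_left_mono mult_nonneg_nonneg) auto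
          also have "\<dots> = (1 - i / K) * (K * (1 - p))" by (simp only: ac_simps)
          also have "\<dots> \<le> (1 - i / K) * ((real m - K) * p)"
            using True i by (intro mult_left_mono) (auto simp: algebra_simps)
          also have "\<dots> = ((1 - i / K) * (real m - K)) * p" by (simp only: ac_simps)
          also have "\<dots> \<le> (real m - real (K + i)) * p"
          proof (intro mult_right_mono)
            have "real i * K \<le> real i * (real m - K)" using KK by (intro mult_left_mono) auto
            thus "(1 - i / K) * (real m - K) \<le> real m - real (K + i)"
              using K0 by (simp add: field_simps)
          qed (use p in auto)
          finally show ?thesis by (simp only: ac_simps)
        qed
        hence "(1 - i / K) * (1 - (real i + 1) / K) * ((real (K + i) + 1) * (1 - p)) * f (K + i)
            \<le> (real m - real (K + i)) * p * f (K + i)"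
          using f0 by (intro mult_right_mono) auto
        also have "\<dots> = (real (K + i) + 1) * (1 - p) * f (Suc (K + i))" using Suc[OF im] by simp
        finally have "(real (K + i) + 1) * (1 - p) * ((1 - i / K) * (1 - (real i + 1) / K) * f (K + i))
             \<le> (real (K + i) + 1) * (1 - p) * f (Suc (K + i))"
          by (simp only: ac_simps)
        moreover have "0 < (real (K + i) + 1) * (1 - p)" using p0 by simp
        ultimately show "(1 - i / K) * (1 - (real i + 1) / K) * f (K + i) \<le> f (K + Suc i)"
          unfolding add_Suc_right by (rule mult_left_le_imp_le)
      qed (use f0 in auto)
      moreover have "K + i \<le> m" if "i\<^sup>2 \<le> K" for i
        using K that power2_nat_le_imp_le[OF that] by linarith
      ultimately show ?thesis by (intro exI[of _ "\<lambda>i. K + i"]) auto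
    next
      case False
      have "(1 - (real i)\<^sup>2 / K) * f (K - 0) \<le> f (K - i)" if "i\<^sup>2 \<le> K" for i
      proof (rule slow_decay[OF _ _ that])
        fix i assume i: "i < K"
        define j where "j = K - Suc i"
        have j: "K - i = Suc j" "j < m" "real j = real K - real i - 1" using i K by (auto simp: j_def)
        have "(1 - i / K) * (1 - (real i + 1) / K) * ((real m - real j) * p) \<le> (real j + 1) * (1 - p)"
        proof -
          have "(1 - (real i + 1) / K) * (real m - real j) \<le> real m - K"
          proof -
            have "(real i + 1) * K \<le> (real i + 1) * (real m - K)" using KK by (intro mult_left_mono) auto
            thus ?thesis using K0 unfolding j(3)
              by (simp add: field_simps) (use zero_le_square[of "real i"] in linarith)
          qed
          hence "(1 - i / K) * p * ((1 - (real i + 1) / K) * (real m - real j)) \<le> (1 - i / K) * p * (real m - K)"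
            using i p by (intro mult_left_mono mult_nonneg_nonneg) auto
          also have "\<dots> = (1 - i / K) * ((real m - K) * p)" by (simp only: ac_simps)
          also have "\<dots> \<le> (1 - i / K) * (K * (1 - p))"
            using False i by (intro mult_left_mono) (auto simp: algebra_simps)
          also have "\<dots> = (real j + 1) * (1 - p)" using K0 unfolding j(3) by (simp add: field_simps)
          finally show ?thesis by (simp only: ac_simps)
        qed
        hence "(1 - i / K) * (1 - (real i + 1) / K) * ((real m - real j) * p) * f (Suc j)
            \<le> (real j + 1) * (1 - p) * f (Suc j)"
          using f0 by (intro mult_right_mono) auto
        also have "\<dots> = (real m - real j) * p * f j" using Suc[OF j(2)] by simp
        finally have "(real m - real j) * p * ((1 - i / K) * (1 - (real i + 1) / K) * f (Suc j))
            \<le> (real m - real j) * p * f j"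
          by (simp only: ac_simps)
        moreover have "0 < (real m - real j) * p" using p0 j by simp
        ultimately show "(1 - i / K) * (1 - (real i + 1) / K) * f (K - i) \<le> f (K - Suc i)"
          unfolding j(1) j_def[symmetric] by (rule mult_left_le_imp_le)
      qed (use f0 in auto)
      moreover have "inj_on (\<lambda>i. K - i) {i. i\<^sup>2 \<le> K}"
      proof (rule inj_onI)
        fix i j assume "i \<in> {i. i\<^sup>2 \<le> K}" "j \<in> {i. i\<^sup>2 \<le> K}" "K - i = K - j"
        thus "i = j" using power2_nat_le_imp_le[of i K] power2_nat_le_imp_le[of j K] by simp
      qed
      ultimately show ?thesis using K by (intro exI[of _ "\<lambda>i. K - i"]) auto
    qed
    then obtain h where h: "inj_on h {i. i\<^sup>2 \<le> K}" "h ` {i. i\<^sup>2 \<le> K} \<subseteq> {..m}"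
        "\<And>i. i\<^sup>2 \<le> K \<Longrightarrow> (1 - (real i)\<^sup>2 / K) * f K \<le> f (h i)" by blast
    define r where "r = nat \<lfloor>sqrt (K / 2)\<rfloor>"
    have r: "real r \<le> sqrt (K / 2)" "sqrt (K / 2) < real r + 1"
      unfolding r_def by simp_all
    have small: "(real i)\<^sup>2 \<le> K / 2" if "i \<le> r" for i
    proof -
      have "real i \<le> sqrt (K / 2)" using that r by linarith
      hence "(real i)\<^sup>2 \<le> (sqrt (K / 2))\<^sup>2" by (intro power_mono) auto
      thus ?thesis by simp
    qed
    have sq: "i\<^sup>2 \<le> K" if "i \<le> r" for i
    proof -
      have "(real i)\<^sup>2 \<le> real K" using small[OF that] K0 by linarith
      thus ?thesis by (simp only: of_nat_le_iff flip: of_nat_power)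
    qed
    have half: "f K / 2 \<le> f (h i)" if "i \<le> r" for i
    proof -
      have "(real i)\<^sup>2 / K \<le> 1 / 2" using small[OF that] K0 by (simp add: field_simps)
      hence "1 / 2 * f K \<le> (1 - (real i)\<^sup>2 / K) * f K" using f0 by (intro mult_right_mono) auto
      also have "\<dots> \<le> f (h i)" using h(3) sq[OF that] by blast
      finally show ?thesis by simp
    qed
    have "(real r + 1) * (f K / 2) = (\<Sum>i\<le>r. f K / 2)" by simp
    also have "\<dots> \<le> (\<Sum>i\<le>r. f (h i))" using half by (intro sum_mono) auto
    also have "\<dots> = sum f (h ` {..r})"
      using sq inj_on_subset[OF h(1), of "{..r}"] by (subst sum.reindex) auto
    also have "\<dots> \<le> sum f {..m}" using h(2) sq f0 by (intro sum_mono2) auto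
    finally have "(real r + 1) * (f K / 2) \<le> 1" using f1 by simp
    moreover have "sqrt (K / 2) * (f K / 2) \<le> (real r + 1) * (f K / 2)"
      using r f0 by (intro mult_right_mono) auto
    moreover have "sqrt (real K + 1) / 2 * (f K / 2) \<le> sqrt (K / 2) * (f K / 2)"
    proof (intro mult_right_mono)
      have "sqrt (real K + 1) / 2 = sqrt ((K + 1) / 4)" by (simp add: real_sqrt_divide)
      also have "\<dots> \<le> sqrt (K / 2)" using K0 by (intro real_sqrt_le_mono) (simp add: field_simps)
      finally show "sqrt (real K + 1) / 2 \<le> sqrt (K / 2)" .
    qed (use f0 in auto)
    ultimately have "sqrt (real K + 1) / 2 * (f K / 2) \<le> 1" by linarith
    thus ?thesis unfolding f_def[symmetric] by (simp add: field_simps)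
  qed
qed

section \<open>Product measures\<close>

text \<open>A null set can be recognised by Fubini's theorem along a single coordinate \<open>l\<close>, with all others fixed.\<close>

lemma (in prob_space) AE_PiM_resample:
  assumes I: "finite I" "l \<in> I"
    and meas: "Measurable.pred (Pi\<^sub>M I (\<lambda>_. M)) Q"
    and null: "\<And>w. AE z in M. Q (w(l := z))"
  shows "AE w in Pi\<^sub>M I (\<lambda>_. M). Q w"
proof -
  interpret PS: product_prob_space "\<lambda>_. M" I by unfold_locales
  have I': "insert l (I - {l}) = I" using I by auto
  let ?N = "{w \<in> space (Pi\<^sub>M I (\<lambda>_. M)). \<not> Q w}"
  have N: "?N \<in> sets (Pi\<^sub>M I (\<lambda>_. M))" using meas by measurable
  have "emeasure (Pi\<^sub>M I (\<lambda>_. M)) ?N = (\<integral>\<^sup>+ w. indicator ?N w \<partial>Pi\<^sub>M I (\<lambda>_. M))"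
    using N by simp
  also have "\<dots> = (\<integral>\<^sup>+ w. (\<integral>\<^sup>+ z. indicator ?N (w(l := z)) \<partial>M) \<partial>Pi\<^sub>M (I - {l}) (\<lambda>_. M))"
    using PS.product_nn_integral_insert[of "I - {l}" l "indicator ?N", unfolded I'] I(1) N by simp
  also have "\<dots> = (\<integral>\<^sup>+ w. 0 \<partial>Pi\<^sub>M (I - {l}) (\<lambda>_. M))"
  proof (intro nn_integral_cong)
    fix w
    have "(\<integral>\<^sup>+ z. indicator ?N (w(l := z)) \<partial>M) = (\<integral>\<^sup>+ z. 0 \<partial>M)"
      using null[of w] by (intro nn_integral_cong_AE) (auto simp: indicator_def)
    thus "(\<integral>\<^sup>+ z. indicator ?N (w(l := z)) \<partial>M) = 0" by simp
  qed
  finally have "emeasure (Pi\<^sub>M I (\<lambda>_. M)) ?N = 0" by simp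
  thus ?thesis using N by (subst AE_iff_null) auto
qed

lemma (in prob_space) emeasure_PiM_card_eq:
  assumes J: "finite J" and H: "H \<in> events"
  shows "emeasure (Pi\<^sub>M J (\<lambda>_. M)) {w \<in> space (Pi\<^sub>M J (\<lambda>_. M)). card {l \<in> J. w l \<in> H} = k}
       = ennreal ((card J choose k) * prob H ^ k * (1 - prob H) ^ (card J - k))"
proof -
  interpret PS: product_prob_space "\<lambda>_. M" J by unfold_locales
  define B where "B T = Pi\<^sub>E J (\<lambda>l. if l \<in> T then H else space M - H)" for T
  define TT where "TT = {T. T \<subseteq> J \<and> card T = k}"
  have HS: "H \<subseteq> space M" using H by (rule sets.sets_into_space)
  have B: "B T \<in> sets (Pi\<^sub>M J (\<lambda>_. M))" for T
    unfolding B_def using J H by (intro sets_PiM_I_finite) auto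
  have mem: "w \<in> B T \<longleftrightarrow> w \<in> space (Pi\<^sub>M J (\<lambda>_. M)) \<and> {l \<in> J. w l \<in> H} = T" if "T \<subseteq> J" for w T
    using that HS unfolding B_def space_PiM PiE_iff by (auto split: if_splits)
  have finTT: "finite TT" unfolding TT_def using J by simp
  have "{w \<in> space (Pi\<^sub>M J (\<lambda>_. M)). card {l \<in> J. w l \<in> H} = k} = (\<Union>T\<in>TT. B T)"
  proof (intro set_eqI iffI)
    fix w assume "w \<in> {w \<in> space (Pi\<^sub>M J (\<lambda>_. M)). card {l \<in> J. w l \<in> H} = k}"
    thus "w \<in> (\<Union>T\<in>TT. B T)"
      using mem[of "{l \<in> J. w l \<in> H}" w] by (intro UN_I[of "{l \<in> J. w l \<in> H}"]) (auto simp: TT_def)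
  next
    fix w assume "w \<in> (\<Union>T\<in>TT. B T)"
    then obtain T where "T \<in> TT" "w \<in> B T" by blast
    thus "w \<in> {w \<in> space (Pi\<^sub>M J (\<lambda>_. M)). card {l \<in> J. w l \<in> H} = k}"
      using mem[of T w] by (simp add: TT_def)
  qed
  moreover have "disjoint_family_on B TT"
    unfolding disjoint_family_on_def
  proof (intro ballI impI equals0I)
    fix S T w assume "S \<in> TT" "T \<in> TT" "S \<noteq> T" "w \<in> B S \<inter> B T"
    hence "{l \<in> J. w l \<in> H} = S" "{l \<in> J. w l \<in> H} = T" using mem by (auto simp: TT_def)
    with \<open>S \<noteq> T\<close> show False by simp
  qed
  ultimately have "emeasure (Pi\<^sub>M J (\<lambda>_. M)) {w \<in> space (Pi\<^sub>M J (\<lambda>_. M)). card {l \<in> J. w l \<in> H} = k}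
      = (\<Sum>T\<in>TT. emeasure (Pi\<^sub>M J (\<lambda>_. M)) (B T))"
    using finTT B by (simp add: sum_emeasure image_subset_iff)
  \<comment> \<open>The event is split according to the set \<open>T\<close> of the coordinates that lie in \<open>H\<close>.\<close>
  also have "\<dots> = (\<Sum>T\<in>TT. ennreal (prob H ^ k * (1 - prob H) ^ (card J - k)))"
  proof (intro sum.cong refl)
    fix T assume T: "T \<in> TT"
    hence T': "T \<subseteq> J" "card T = k" "finite T" using J finite_subset unfolding TT_def by auto
    have "emeasure (Pi\<^sub>M J (\<lambda>_. M)) (B T) = (\<Prod>l\<in>J. emeasure M (if l \<in> T then H else space M - H))"
      unfolding B_def using J H by (intro PS.emeasure_PiM) auto
    also have "\<dots> = (\<Prod>l\<in>J. ennreal (if l \<in> T then prob H else 1 - prob H))"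
      using H by (intro prod.cong refl) (auto simp: emeasure_eq_measure prob_compl)
    also have "\<dots> = ennreal (\<Prod>l\<in>J. if l \<in> T then prob H else 1 - prob H)"
      by (rule prod_ennreal) auto
    also have "(\<Prod>l\<in>J. if l \<in> T then prob H else 1 - prob H) = prob H ^ k * (1 - prob H) ^ (card J - k)"
    proof -
      have "J \<inter> T = T" "J \<inter> - T = J - T" using T' by auto
      thus ?thesis using J T' by (simp add: prod.If_cases card_Diff_subset)
    qed
    finally show "emeasure (Pi\<^sub>M J (\<lambda>_. M)) (B T) = ennreal (prob H ^ k * (1 - prob H) ^ (card J - k))" .
  qed
  also have "\<dots> = ennreal (\<Sum>T\<in>TT. prob H ^ k * (1 - prob H) ^ (card J - k))"
    by (rule sum_ennreal) auto
  also have "(\<Sum>T\<in>TT. prob H ^ k * (1 - prob H) ^ (card J - k))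
      = (card J choose k) * prob H ^ k * (1 - prob H) ^ (card J - k)"
    using n_subsets[OF J, of k] unfolding TT_def by simp
  finally show ?thesis .
qed

lemma pred_card_eq:
  assumes J: "finite J" and Q: "\<And>l. l \<in> J \<Longrightarrow> Measurable.pred M (Q l)"
  shows "Measurable.pred M (\<lambda>w. card {l \<in> J. Q l w} = k)"
proof -
  have "(\<lambda>w. card {l \<in> J. Q l w} = k) = (\<lambda>w. \<exists>T\<in>Pow J. card T = k \<and> (\<forall>l\<in>J. Q l w \<longleftrightarrow> l \<in> T))"
  proof (intro ext iffI)
    fix w assume "card {l \<in> J. Q l w} = k"
    thus "\<exists>T\<in>Pow J. card T = k \<and> (\<forall>l\<in>J. Q l w \<longleftrightarrow> l \<in> T)"
      by (intro bexI[of _ "{l \<in> J. Q l w}"]) auto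
  next
    fix w assume "\<exists>T\<in>Pow J. card T = k \<and> (\<forall>l\<in>J. Q l w \<longleftrightarrow> l \<in> T)"
    then obtain T where "T \<subseteq> J" "card T = k" "\<forall>l\<in>J. Q l w \<longleftrightarrow> l \<in> T" by blast
    moreover from this have "{l \<in> J. Q l w} = T" by auto
    ultimately show "card {l \<in> J. Q l w} = k" by simp
  qed
  moreover have "Measurable.pred M (\<lambda>w. \<exists>T\<in>Pow J. card T = k \<and> (\<forall>l\<in>J. Q l w \<longleftrightarrow> l \<in> T))"
    using J Q by (intro pred_intros_finite pred_intros_logic) auto
  ultimately show ?thesis by simp
qed

text \<open>Given the points \<open>i\<close> and \<open>j\<close>, the number of the remaining points in the halfplane has a
binomial distribution, so it equals \<open>K\<close> with conditional probability at most
\<open>4 / sqrt (K + 1)\<close>. The condition \<open>R\<close> concerns the points \<open>i\<close> and \<open>j\<close> alone and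
contributes the factor \<open>r\<close>. The first claim is the measurability of the event.\<close>

lemma prob_pair_and_card_le:
  fixes M :: "(real^2) measure" and e :: real
  assumes M: "prob_space M" and setsM: "sets M = sets borel"
    and I: "finite I" "i \<in> I" "j \<in> I" "i \<noteq> j"
    and K: "2 * K \<le> card I - 2"
    and R: "Measurable.pred (M \<Otimes>\<^sub>M M) (\<lambda>(x, y). R x y)" "\<And>x. measure M {y \<in> space M. R x y} \<le> r"
  shows "Measurable.pred (Pi\<^sub>M I (\<lambda>_. M)) (\<lambda>w. R (w i) (w j) \<and> card {l \<in> I. 0 < e * orient (w i) (w j) (w l)} = K)" (is "Measurable.pred _ ?Q")
    and "measure (Pi\<^sub>M I (\<lambda>_. M)) {w \<in> space (Pi\<^sub>M I (\<lambda>_. M)).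
            R (w i) (w j) \<and> card {l \<in> I. 0 < e * orient (w i) (w j) (w l)} = K} \<le> 4 / sqrt (real K + 1) * r"
      (is "measure ?PI ?E \<le> ?b * r")
proof -
  interpret prob_space M by fact
  interpret PS: product_prob_space "\<lambda>_. M" I by unfold_locales
  note [measurable_cong] = setsM
  have spaceM: "space M = UNIV" using sets_eq_imp_space_eq[OF setsM] by simp
  have [measurable]: "(\<lambda>w. w l) \<in> borel_measurable (Pi\<^sub>M I (\<lambda>_. M))" if "l \<in> I" for l
    using measurable_component_singleton[OF that, of "\<lambda>_. M"] setsM
    by (simp cong: measurable_cong_sets)
  have mR: "Measurable.pred N (\<lambda>w. R (f w) (g w))" if "f \<in> measurable N M" "g \<in> measurable N M" for f g N
    using measurable_compose[OF measurable_Pair[OF that] R(1)] by simp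
  have comp: "(\<lambda>w. w l) \<in> measurable (Pi\<^sub>M I (\<lambda>_. M)) M" if "l \<in> I" for l
    using that by (rule measurable_component_singleton)
  show Q: "Measurable.pred (Pi\<^sub>M I (\<lambda>_. M)) ?Q"
  proof (intro pred_intros_logic pred_card_eq I)
    show "Measurable.pred (Pi\<^sub>M I (\<lambda>_. M)) (\<lambda>w. R (w i) (w j))" using comp I by (intro mR) auto
    show "Measurable.pred (Pi\<^sub>M I (\<lambda>_. M)) (\<lambda>w. 0 < e * orient (w i) (w j) (w l))" if "l \<in> I" for l
    proof -
      have [measurable]: "(\<lambda>w. orient (w i) (w j) (w l)) \<in> borel_measurable (Pi\<^sub>M I (\<lambda>_. M))"
        using that I by (intro orient_measurable) measurable
      show ?thesis by measurable
    qed
  qed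
  define J where "J = I - {i, j}"
  have J: "finite J" "i \<notin> insert j J" "j \<notin> J" "insert i (insert j J) = I" "card J = card I - 2"
    unfolding J_def using I by (auto simp: card_Diff_subset)
  have E: "?E \<in> sets ?PI" using Q by measurable
  have b0: "0 \<le> ?b" by simp
  define G where "G x y = {z. 0 < e * orient x y z}" for x y
  have G: "G x y \<in> events" for x y
  proof -
    have "{z \<in> space borel. 0 < e * orient x y z} \<in> sets borel" by measurable
    thus ?thesis unfolding G_def using setsM by simp
  qed
  \<comment> \<open>The two points on the line have orientation 0, so only the coordinates in \<open>J\<close> are counted.\<close>
  have inner: "(\<integral>\<^sup>+ w. indicator ?E (w(j := y, i := x)) \<partial>Pi\<^sub>M J (\<lambda>_. M)) \<le> ennreal ?b * indicator {y. R x y} y" for x y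
  proof (cases "R x y")
    case True
    have "(\<integral>\<^sup>+ w. indicator ?E (w(j := y, i := x)) \<partial>Pi\<^sub>M J (\<lambda>_. M))
        \<le> (\<integral>\<^sup>+ w. indicator {w \<in> space (Pi\<^sub>M J (\<lambda>_. M)). card {l \<in> J. w l \<in> G x y} = K} w \<partial>Pi\<^sub>M J (\<lambda>_. M))"
    proof (intro nn_integral_mono)
      fix w assume w: "w \<in> space (Pi\<^sub>M J (\<lambda>_. M))"
      have "{l \<in> I. 0 < e * orient x y ((w(j := y, i := x)) l)} = {l \<in> J. w l \<in> G x y}"
        using J I unfolding J_def G_def by auto
      thus "indicator ?E (w(j := y, i := x)) \<le>
         (indicator {w \<in> space (Pi\<^sub>M J (\<lambda>_. M)). card {l \<in> J. w l \<in> G x y} = K} w :: ennreal)"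
        using w I by (auto simp: indicator_def)
    qed
    also have "\<dots> = emeasure (Pi\<^sub>M J (\<lambda>_. M)) {w \<in> space (Pi\<^sub>M J (\<lambda>_. M)). card {l \<in> J. w l \<in> G x y} = K}"
    proof (intro nn_integral_indicator)
      have "Measurable.pred (Pi\<^sub>M J (\<lambda>_. M)) (\<lambda>w. w l \<in> G x y)" if "l \<in> J" for l
        using measurable_component_singleton[OF that, of "\<lambda>_. M"] G by measurable
      hence "Measurable.pred (Pi\<^sub>M J (\<lambda>_. M)) (\<lambda>w. card {l \<in> J. w l \<in> G x y} = K)"
        using J by (intro pred_card_eq)
      thus "{w \<in> space (Pi\<^sub>M J (\<lambda>_. M)). card {l \<in> J. w l \<in> G x y} = K} \<in> sets (Pi\<^sub>M J (\<lambda>_. M))"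
        by measurable
    qed
    also have "\<dots> = ennreal ((card J choose K) * prob (G x y) ^ K * (1 - prob (G x y)) ^ (card J - K))"
      using J G by (intro emeasure_PiM_card_eq)
    also have "\<dots> \<le> ennreal ?b"
      using K J by (intro ennreal_leI binomial_pmf_le) auto
    finally show ?thesis using True by simp
  next
    case False
    hence "indicator ?E (w(j := y, i := x)) = (0 :: ennreal)" for w using I(4) by simp
    thus ?thesis by simp
  qed
  have mid: "(\<integral>\<^sup>+ y. (\<integral>\<^sup>+ w. indicator ?E (w(j := y, i := x)) \<partial>Pi\<^sub>M J (\<lambda>_. M)) \<partial>M) \<le> ennreal (?b * r)" for x
  proof -
    have "Measurable.pred M (\<lambda>y. R x y)" by (rule mR) (simp_all add: spaceM)
    hence mRx: "{y \<in> space M. R x y} \<in> events" unfolding pred_def .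
    have "(\<integral>\<^sup>+ y. (\<integral>\<^sup>+ w. indicator ?E (w(j := y, i := x)) \<partial>Pi\<^sub>M J (\<lambda>_. M)) \<partial>M)
        \<le> (\<integral>\<^sup>+ y. ennreal ?b * indicator {y \<in> space M. R x y} y \<partial>M)"
      using inner spaceM by (intro nn_integral_mono) simp
    also have "\<dots> = ennreal ?b * emeasure M {y \<in> space M. R x y}"
      using mRx by (rule nn_integral_cmult_indicator)
    also have "\<dots> = ennreal (?b * prob {y \<in> space M. R x y})"
      by (simp only: emeasure_eq_measure ennreal_mult[OF b0 measure_nonneg])
    also have "\<dots> \<le> ennreal (?b * r)"
      using R(2) b0 by (intro ennreal_leI mult_left_mono)
    finally show ?thesis .
  qed
  have "emeasure ?PI ?E = (\<integral>\<^sup>+ w. indicator ?E w \<partial>?PI)" using E by simp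
  also have "\<dots> = (\<integral>\<^sup>+ x. (\<integral>\<^sup>+ w. indicator ?E (w(i := x)) \<partial>Pi\<^sub>M (insert j J) (\<lambda>_. M)) \<partial>M)"
    using PS.product_nn_integral_insert_rev[of "insert j J" i "indicator ?E"] J E by simp
  also have "\<dots> = (\<integral>\<^sup>+ x. (\<integral>\<^sup>+ y. (\<integral>\<^sup>+ w. indicator ?E (w(j := y, i := x)) \<partial>Pi\<^sub>M J (\<lambda>_. M)) \<partial>M) \<partial>M)"
  proof (intro nn_integral_cong)
    fix x assume x: "x \<in> space M"
    have "(\<lambda>w. w(i := x)) \<in> measurable (Pi\<^sub>M (insert j J) (\<lambda>_. M)) ?PI"
      using x J(4) by (intro measurable_fun_upd[where J = "insert j J"]) auto
    hence "(\<lambda>w. indicator ?E (w(i := x)) :: ennreal) \<in> borel_measurable (Pi\<^sub>M (insert j J) (\<lambda>_. M))"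
      by (rule measurable_compose[OF _ borel_measurable_indicator[OF E]])
    thus "(\<integral>\<^sup>+ w. indicator ?E (w(i := x)) \<partial>Pi\<^sub>M (insert j J) (\<lambda>_. M)) =
       (\<integral>\<^sup>+ y. (\<integral>\<^sup>+ w. indicator ?E (w(j := y, i := x)) \<partial>Pi\<^sub>M J (\<lambda>_. M)) \<partial>M)"
      by (rule PS.product_nn_integral_insert_rev[OF J(1,3)])
  qed
  also have "\<dots> \<le> (\<integral>\<^sup>+ x. ennreal (?b * r) \<partial>M)" using mid by (intro nn_integral_mono)
  also have "\<dots> = ennreal (?b * r)" by (simp add: emeasure_space_1)
  finally have "emeasure ?PI ?E \<le> ennreal (?b * r)" .
  moreover have "0 \<le> ?b * r" using b0 order_trans[OF measure_nonneg R(2)]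
    by (rule mult_nonneg_nonneg)
  ultimately show "measure ?PI ?E \<le> ?b * r" unfolding measure_def by (intro enn2real_leI)
qed

section \<open>Quantile strips\<close>

text \<open>The separators are the \<open>i / s\<close>-quantiles for \<open>0 < i < s\<close>, which exist because the distribution
function is continuous. From \<open>u\<close> one gets past the next quantile only by crossing it, and that
quantile is at most \<open>1 / s\<close> away in probability. Beyond the last quantile, only the
probability \<open>1 / s\<close> is left.\<close>

lemma (in real_distribution) ex_quantile_separators:
  assumes atomless: "\<And>a. prob {a} = 0" and s: "0 < s"
  shows "\<exists>T. finite T \<and> card T \<le> s - 1 \<and>
           (\<forall>u. prob {v. u < v \<and> (\<forall>t\<in>T. \<not> (u < t \<and> t < v))} \<le> 1 / real s)"
proof -
  have cont: "isCont (cdf M) a" for a using atomless by (simp add: isCont_cdf)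
  have "\<exists>t. cdf M t = real i / real s" if i: "i \<in> {1..<s}" for i
  proof -
    have "eventually (\<lambda>a. cdf M a < real i / real s) at_bot"
      using i s by (intro order_tendstoD[OF cdf_lim_at_bot]) auto
    then obtain a where a: "cdf M a < real i / real s"
      by (metis eventually_at_bot_linorder order_refl)
    have "eventually (\<lambda>b. real i / real s < cdf M b) at_top"
      using i s by (intro order_tendstoD[OF cdf_lim_at_top_prob]) auto
    then obtain b where b: "real i / real s < cdf M b"
      by (metis eventually_at_top_linorder order_refl)
    have "a \<le> b" using cdf_nondecreasing[of b a] a b by linarith
    thus ?thesis using IVT[of "cdf M" a "real i / real s" b] a b cont by auto
  qed
  then obtain q where q: "\<And>i. i \<in> {1..<s} \<Longrightarrow> cdf M (q i) = real i / real s" by metis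
  define T where "T = q ` {1..<s}"
  have "prob {v. u < v \<and> (\<forall>t\<in>T. \<not> (u < t \<and> t < v))} \<le> 1 / real s" for u
  proof -
    \<comment> \<open>The number \<open>c\<close> is the index of the first quantile beyond \<open>u\<close>; there is none if \<open>s \<le> c\<close>.\<close>
    define c where "c = nat \<lfloor>real s * cdf M u\<rfloor> + 1"
    have "real_of_int \<lfloor>real s * cdf M u\<rfloor> = real c - 1"
      unfolding c_def using cdf_nonneg[of u] by simp
    hence "real c - 1 \<le> real s * cdf M u" "real s * cdf M u < real c" by linarith+
    hence c: "(real c - 1) / real s \<le> cdf M u" "cdf M u < real c / real s"
      using s by (simp_all add: field_simps)
    show ?thesis
    proof (cases "c < s")
      case True
      hence cs: "c \<in> {1..<s}" by (simp add: c_def)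
      have ut: "u < q c" using c(2) q[OF cs] cdf_nondecreasing[of "q c" u] by linarith
      have "prob {v. u < v \<and> (\<forall>t\<in>T. \<not> (u < t \<and> t < v))} \<le> prob {u<..q c}"
      proof (rule finite_measure_mono)
        show "{v. u < v \<and> (\<forall>t\<in>T. \<not> (u < t \<and> t < v))} \<subseteq> {u<..q c}"
          using cs ut unfolding T_def by force
      qed auto
      also have "\<dots> = real c / real s - cdf M u" using cdf_diff_eq[OF ut] q[OF cs] by simp
      also have "\<dots> \<le> 1 / real s" using c(1) by (simp add: diff_divide_distrib)
      finally show ?thesis .
    next
      case False
      have "prob {v. u < v \<and> (\<forall>t\<in>T. \<not> (u < t \<and> t < v))} \<le> prob (space M - {..u})"
        by (rule finite_measure_mono) auto
      also have "\<dots> = 1 - cdf M u" by (subst prob_compl) (auto simp: cdf_def)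
      also have "\<dots> \<le> 1 - (real c - 1) / real s" using c(1) by simp
      also have "\<dots> \<le> 1 - (real s - 1) / real s"
        using False s by (intro diff_left_mono divide_right_mono) auto
      also have "\<dots> = 1 / real s" using s by (simp add: field_simps)
      finally show ?thesis .
    qed
  qed
  moreover have "finite T" "card T \<le> s - 1"
    unfolding T_def using card_image_le[of "{1..<s}" q] by auto
  ultimately show ?thesis by blast
qed

lemma AE_not_collinear:
  fixes P :: "(real^2) measure"
  assumes setsP: "sets P = sets borel"
    and "x \<noteq> y" and null: "emeasure P (affine hull {x, y}) = 0"
  shows "AE z in P. orient x y z \<noteq> 0"
proof (rule AE_I)
  show "{z \<in> space P. \<not> orient x y z \<noteq> 0} \<subseteq> affine hull {x, y}"
    using orient_eq_0_imp_affine_hull[OF _ \<open>x \<noteq> y\<close>] by auto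
  show "emeasure P (affine hull {x, y}) = 0" by fact
  show "affine hull {x, y} \<in> sets P" using setsP by (simp add: closed_affine_hull borel_closed)
qed

lemma AE_not_vertical:
  fixes P :: "(real^2) measure"
  assumes setsP: "sets P = sets borel"
    and lines: "\<And>x y. x \<noteq> y \<Longrightarrow> emeasure P (affine hull {x, y}) = 0"
  shows "AE z in P. z $ 1 \<noteq> t"
proof -
  define x :: "real^2" where "x = (\<chi> i. if i = 1 then t else 0)"
  define y :: "real^2" where "y = (\<chi> i. if i = 1 then t else 1)"
  have xy: "x $ 1 = t" "x $ 2 = 0" "y $ 1 = t" "y $ 2 = 1" by (simp_all add: x_def y_def)
  hence "x \<noteq> y" by (metis zero_neq_one)
  from AE_not_collinear[OF setsP this lines[OF this]] show ?thesis
    by eventually_elim (simp add: orient_def xy)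
qed

lemma ex_vertical_separators:
  fixes P :: "(real^2) measure"
  assumes P: "prob_space P" and setsP: "sets P = sets borel"
    and lines: "\<And>x y. x \<noteq> y \<Longrightarrow> emeasure P (affine hull {x, y}) = 0"
    and s: "0 < s"
  obtains T where "finite T" "card T \<le> s - 1"
    "\<And>u. measure P {z \<in> space P. u < z $ 1 \<and> (\<forall>t\<in>T. \<not> (u < t \<and> t < z $ 1))} \<le> 1 / real s"
proof -
  interpret prob_space P by fact
  have X: "(\<lambda>z. z $ 1) \<in> borel_measurable P"
    using measurable_vec_nth_2 setsP by (simp cong: measurable_cong_sets)
  define D where "D = distr P borel (\<lambda>z. z $ 1)"
  interpret D: real_distribution D
    unfolding D_def using X by (rule real_distribution_distr)
  have "D.prob {a} = 0" for a
  proof -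
    have "AE z in P. z $ 1 \<noteq> a" using setsP lines by (rule AE_not_vertical)
    hence "prob {z \<in> space P. z $ 1 = a} = 0"
      using X by (subst prob_eq_0) auto
    moreover have "(\<lambda>z. z $ 1) -` {a} \<inter> space P = {z \<in> space P. z $ 1 = a}" by auto
    ultimately show ?thesis unfolding D_def using X by (simp add: measure_distr)
  qed
  then obtain T where T: "finite T" "card T \<le> s - 1"
      "\<And>u. D.prob {v. u < v \<and> (\<forall>t\<in>T. \<not> (u < t \<and> t < v))} \<le> 1 / real s"
    using D.ex_quantile_separators[OF _ s] by blast
  show ?thesis
  proof (rule that[OF T(1,2)])
    fix u
    let ?S = "{v. u < v \<and> (\<forall>t\<in>T. \<not> (u < t \<and> t < v))}"
    have "{v \<in> space borel. u < v \<and> (\<forall>t\<in>T. \<not> (u < t \<and> t < v))} \<in> sets borel"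
      using T(1) by measurable
    hence "D.prob ?S = prob ((\<lambda>z. z $ 1) -` ?S \<inter> space P)"
      unfolding D_def using X by (intro measure_distr) auto
    also have "(\<lambda>z. z $ 1) -` ?S \<inter> space P = {z \<in> space P. u < z $ 1 \<and> (\<forall>t\<in>T. \<not> (u < t \<and> t < z $ 1))}"
      by auto
    finally show "prob {z \<in> space P. u < z $ 1 \<and> (\<forall>t\<in>T. \<not> (u < t \<and> t < z $ 1))} \<le> 1 / real s"
      using T(3)[of u] by simp
  qed
qed

section \<open>General position\<close>

text \<open>For three points, the last one is resampled: once the first two have different abscissae, they
span a line, and this line is null. For two points, the vertical line through one of them is null.\<close>

lemma AE_general_position:
  fixes P :: "(real^2) measure" and n :: nat
  assumes P: "prob_space P" and setsP: "sets P = sets borel"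
    and lines: "\<And>x y. x \<noteq> y \<Longrightarrow> emeasure P (affine hull {x, y}) = 0"
  shows "AE w in Pi\<^sub>M {..<n} (\<lambda>_. P).
           (\<forall>i<n. \<forall>j<n. i \<noteq> j \<longrightarrow> w i $ 1 \<noteq> w j $ 1) \<and>
           (\<forall>i<n. \<forall>j<n. \<forall>l<n. i \<noteq> j \<longrightarrow> l \<noteq> i \<longrightarrow> l \<noteq> j \<longrightarrow> orient (w i) (w j) (w l) \<noteq> 0)"
proof -
  interpret prob_space P by fact
  let ?PI = "Pi\<^sub>M {..<n} (\<lambda>_. P)"
  have vert: "AE z in P. z $ 1 \<noteq> t" for t using setsP lines by (rule AE_not_vertical)
  have coord: "(\<lambda>w. w l) \<in> borel_measurable ?PI" if "l < n" for l
    using measurable_component_singleton[of l "{..<n}" "\<lambda>_. P"] that setsP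
    by (simp cong: measurable_cong_sets)
  have nth: "(\<lambda>w. w l $ k) \<in> borel_measurable ?PI" if "l < n" for l k
    using coord[OF that] measurable_vec_nth_2 by (rule measurable_compose)
  have neq_0: "Measurable.pred ?PI (\<lambda>w. f w \<noteq> 0)"
    if [measurable]: "f \<in> borel_measurable ?PI" for f :: "_ \<Rightarrow> real"
    by measurable
  have 1: "AE w in ?PI. w i $ 1 \<noteq> w j $ 1" if "i < n" "j < n" and ij: "i \<noteq> j" for i j
  proof (rule AE_PiM_resample[of _ j])
    show "Measurable.pred ?PI (\<lambda>w. w i $ 1 \<noteq> w j $ 1)"
      using neq_0[of "\<lambda>w. w i $ 1 - w j $ 1"] nth that by simp
    show "AE z in P. (w(j := z)) i $ 1 \<noteq> (w(j := z)) j $ 1" for w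
      using vert[of "w i $ 1"] by eventually_elim (use ij in auto)
  qed (use that in auto)
  have 2: "AE w in ?PI. w i $ 1 \<noteq> w j $ 1 \<longrightarrow> orient (w i) (w j) (w l) \<noteq> 0"
    if "i < n" "j < n" "l < n" and d: "l \<noteq> i" "l \<noteq> j" for i j l
  proof (rule AE_PiM_resample[of _ l])
    show "Measurable.pred ?PI (\<lambda>w. w i $ 1 \<noteq> w j $ 1 \<longrightarrow> orient (w i) (w j) (w l) \<noteq> 0)"
    proof (rule pred_intros_logic(4))
      show "Measurable.pred ?PI (\<lambda>w. w i $ 1 \<noteq> w j $ 1)"
        using neq_0[of "\<lambda>w. w i $ 1 - w j $ 1"] nth that by simp
      show "Measurable.pred ?PI (\<lambda>w. orient (w i) (w j) (w l) \<noteq> 0)"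
        using that by (intro neq_0 orient_measurable coord)
    qed
    show "AE z in P. (w(l := z)) i $ 1 \<noteq> (w(l := z)) j $ 1 \<longrightarrow>
            orient ((w(l := z)) i) ((w(l := z)) j) ((w(l := z)) l) \<noteq> 0" for w
    proof (cases "w i $ 1 = w j $ 1")
      case False
      hence "w i \<noteq> w j" by auto
      from AE_not_collinear[OF setsP this lines[OF this]] show ?thesis
        by eventually_elim (use d in auto)
    qed (use d in auto)
  qed (use that in auto)
  have "AE w in ?PI. \<forall>i\<in>{..<n}. \<forall>j\<in>{..<n}. i \<noteq> j \<longrightarrow> w i $ 1 \<noteq> w j $ 1"
    using 1 by (intro AE_finite_allI) (auto intro!: AE_impI)
  moreover have "AE w in ?PI. \<forall>i\<in>{..<n}. \<forall>j\<in>{..<n}. \<forall>l\<in>{..<n}.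
      l \<noteq> i \<longrightarrow> l \<noteq> j \<longrightarrow> w i $ 1 \<noteq> w j $ 1 \<longrightarrow> orient (w i) (w j) (w l) \<noteq> 0"
    using 2 by (intro AE_finite_allI) (auto intro!: AE_impI)
  ultimately show ?thesis
  proof eventually_elim
    case (elim w)
    thus ?case by auto
  qed
qed

section \<open>The expected number of k-edges\<close>

text \<open>With \<open>a = (K + 1) powr (1 / 4)\<close> and \<open>s\<close> strips, the pairs within a strip contribute \<open>4 * n\<^sup>2 / (a\<^sup>2 * s)\<close> and
the crossing pairs \<open>(s - 1) * a ^ 4\<close>. The choice \<open>s = n / a ^ 3\<close> makes both of the order \<open>n * a\<close>; rounding
up is harmless because only \<open>s - 1\<close> enters the second term. The factor 2 stands for the two
sides of a line.\<close>

lemma optimal_strip_count: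
  fixes n K k :: nat
  assumes "0 < n" "K \<le> k"
  defines "s \<equiv> nat \<lceil>real n / (real K + 1) powr (3 / 4)\<rceil>"
  shows "0 < s"
    and "2 * (real n * real n * (4 / sqrt (real K + 1) * (1 / real s)) + real (s - 1) * (real K + 1))
          \<le> 10 * real n * (real k + 1) powr (1 / 4)"
proof -
  define a where "a = (real K + 1) powr (1 / 4)"
  have a: "0 < a" by (simp add: a_def)
  have "a ^ m = (real K + 1) powr (m / 4)" for m :: nat
    unfolding a_def by (simp add: powr_powr flip: powr_realpow)
  from this[of 2] this[of 3] this[of 4]
  have pow: "sqrt (real K + 1) = a ^ 2" "(real K + 1) powr (3 / 4) = a ^ 3" "real K + 1 = a ^ 4"
    by (simp_all add: powr_half_sqrt)
  have pos: "0 < real n / a ^ 3" using a assms(1) by simp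
  thus s: "0 < s" unfolding s_def pow(2) by simp
  have "real s = of_int \<lceil>real n / a ^ 3\<rceil>" unfolding s_def pow(2) using pos by simp
  hence lo: "real n / a ^ 3 \<le> real s" and "real s - 1 < real n / a ^ 3" by linarith+
  hence hi: "real (s - 1) \<le> real n / a ^ 3" using s by simp
  have "real n * real n * (4 / a ^ 2 * (1 / real s)) \<le> real n * real n * (4 / a ^ 2 * (1 / (real n / a ^ 3)))"
    using lo pos s by (intro mult_left_mono divide_left_mono mult_pos_pos) auto
  also have "\<dots> = 4 * real n * a"
    using a assms(1) by (simp add: field_simps power2_eq_square power3_eq_cube)
  finally have A: "real n * real n * (4 / a ^ 2 * (1 / real s)) \<le> 4 * real n * a" .
  have "real (s - 1) * a ^ 4 \<le> real n / a ^ 3 * a ^ 4" using hi a by (intro mult_right_mono) auto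
  also have "\<dots> = real n * a" using a by (simp add: field_simps power3_eq_cube power4_eq_xxxx)
  finally have B: "real (s - 1) * a ^ 4 \<le> real n * a" .
  have "real n * a \<le> real n * (real k + 1) powr (1 / 4)"
    unfolding a_def using assms(2) by (intro mult_left_mono powr_mono2) auto
  with A B show "2 * (real n * real n * (4 / sqrt (real K + 1) * (1 / real s)) + real (s - 1) * (real K + 1))
          \<le> 10 * real n * (real k + 1) powr (1 / 4)"
    unfolding pow(1) unfolding pow(3) by (simp add: mult.assoc)
qed

theorem theorem1p3:
  fixes P :: "(real^2) measure" and n k :: nat
  assumes "prob_space P"
    and "sets P = sets borel"
    and "\<And>x y. x \<noteq> y \<Longrightarrow> emeasure P (affine hull {x, y}) = 0"
    and "n \<ge> 3"
    and "k \<le> n - 2"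
  shows "expected_k_edges P k n \<le> 10 * real n * (real k + 1) powr (1 / 4)"
proof -
  interpret prob_space P by fact
  let ?PI = "Pi\<^sub>M {..<n} (\<lambda>_. P)"
  interpret PI: prob_space ?PI by (intro prob_space_PiM assms(1))
  \<comment> \<open>The smaller of the two halfplane counts, so that the bound on binomial probabilities applies.\<close>
  define K where "K = min k (n - 2 - k)"
  have K: "K \<le> k" "2 * K \<le> n - 2" "K = k \<or> K = n - 2 - k" unfolding K_def by auto
  define s where "s = nat \<lceil>real n / (real K + 1) powr (3 / 4)\<rceil>"
  have s: "0 < s" using optimal_strip_count(1)[OF _ K(1), of n] assms(4) by (simp add: s_def)
  obtain T where T: "finite T" "card T \<le> s - 1"
      "\<And>u. prob {z \<in> space P. u < z $ 1 \<and> (\<forall>t\<in>T. \<not> (u < t \<and> t < z $ 1))} \<le> 1 / real s"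
    using ex_vertical_separators[OF assms(1,2) _ s] assms(3) by blast
  \<comment> \<open>In the event \<open>R\<close>, no separator lies strictly between the points, so they share a strip.\<close>
  define R where "R x y \<longleftrightarrow> x $ 1 < y $ 1 \<and> (\<forall>t\<in>T. \<not> (x $ 1 < t \<and> t < y $ 1))" for x y :: "real^2"
  have R: "Measurable.pred (P \<Otimes>\<^sub>M P) (\<lambda>(x, y). R x y)"
  proof -
    have X: "(\<lambda>z. z $ 1) \<in> borel_measurable P"
      using measurable_vec_nth_2 assms(2) by (simp cong: measurable_cong_sets)
    have [measurable]: "(\<lambda>q. fst q $ 1) \<in> borel_measurable (P \<Otimes>\<^sub>M P)"
        "(\<lambda>q. snd q $ 1) \<in> borel_measurable (P \<Otimes>\<^sub>M P)"
      by (rule measurable_compose[OF _ X]; simp)+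
    show ?thesis unfolding R_def case_prod_beta using T(1) by measurable
  qed
  define close where "close e i j w \<longleftrightarrow>
      R (w i) (w j) \<and> card {l \<in> {..<n}. 0 < e * orient (w i) (w j) (w l)} = K" for e i j and w :: "nat \<Rightarrow> real^2"
  define off where "off = {(i, j) \<in> {..<n} \<times> {..<n}. i \<noteq> j}"
  define E where "E e q = {w \<in> space ?PI. close e (fst q) (snd q) w}" for e q
  have off: "finite off" "card off \<le> n * n"
  proof -
    show "finite off" unfolding off_def by (rule finite_subset[of _ "{..<n} \<times> {..<n}"]) auto
    have "card off \<le> card ({..<n} \<times> {..<n})" unfolding off_def by (intro card_mono) auto
    thus "card off \<le> n * n" by simp
  qed
  have E: "E e q \<in> PI.events" "PI.prob (E e q) \<le> 4 / sqrt (real K + 1) * (1 / real s)" if "q \<in> off" for e q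
  proof -
    have ij: "fst q \<in> {..<n}" "snd q \<in> {..<n}" "fst q \<noteq> snd q" using that unfolding off_def by auto
    have Rs: "prob {y \<in> space P. R x y} \<le> 1 / real s" for x using T(3)[of "x $ 1"] by (simp add: R_def)
    note pair = prob_pair_and_card_le[OF assms(1,2) finite_lessThan ij _ R Rs, where e = e and K = K]
    show "E e q \<in> PI.events" "PI.prob (E e q) \<le> 4 / sqrt (real K + 1) * (1 / real s)"
      using pair K(2) unfolding E_def close_def pred_def by auto
  qed
  \<comment> \<open>Indicators of the pairs in a common strip, plus the bound on the crossing pairs, for both sides.\<close>
  define g where "g w = (\<Sum>e\<in>{1, -1}. (\<Sum>q\<in>off. indicat_real (E e q) w) + real (s - 1) * (real K + 1))" for w
  have int: "integrable ?PI (indicat_real (E e q))" if "q \<in> off" for e q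
    using E(1)[OF that] by (simp add: PI.emeasure_eq_measure)
  have "expected_k_edges P k n \<le> (\<integral>w. g w \<partial>?PI)"
    unfolding expected_k_edges_def
  proof (rule integral_mono_AE')
    show "integrable ?PI g" unfolding g_def using int by simp
    show "AE w in ?PI. 0 \<le> g w" unfolding g_def by (intro AE_I2 sum_nonneg add_nonneg_nonneg) auto
    have "AE w in ?PI. w \<in> space ?PI" by (rule AE_space)
    moreover have "AE w in ?PI. (\<forall>i<n. \<forall>j<n. i \<noteq> j \<longrightarrow> w i $ 1 \<noteq> w j $ 1) \<and>
           (\<forall>i<n. \<forall>j<n. \<forall>l<n. i \<noteq> j \<longrightarrow> l \<noteq> i \<longrightarrow> l \<noteq> j \<longrightarrow> orient (w i) (w j) (w l) \<noteq> 0)"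
      using assms(1-3) by (rule AE_general_position)
    ultimately
    show "AE w in ?PI. real (card (k_edges k (w ` {..<n}))) \<le> g w"
    proof (eventually_elim)
      case (elim w)
      hence xs: "\<And>i j. \<lbrakk>i < n; j < n; i \<noteq> j\<rbrakk> \<Longrightarrow> w i $ 1 \<noteq> w j $ 1"
        and gp: "\<And>i j l. \<lbrakk>i < n; j < n; l < n; i \<noteq> j; l \<noteq> i; l \<noteq> j\<rbrakk> \<Longrightarrow> orient (w i) (w j) (w l) \<noteq> 0"
        and w: "w \<in> space ?PI" by auto
      have strip: "real (card {(i, j) \<in> {..<n} \<times> {..<n}. w i $ 1 < w j $ 1 \<and>
              card {l \<in> {..<n}. 0 < e * orient (w i) (w j) (w l)} = K})
          \<le> (\<Sum>q\<in>off. indicat_real (E e q) w) + real (s - 1) * (real K + 1)"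
        (is "real (card ?A) \<le> _") if "e \<in> {1, -1}" for e :: real
      proof -
        let ?B = "{(i, j) \<in> {..<n} \<times> {..<n}. (w i $ 1 < w j $ 1 \<and> (\<forall>t\<in>T. \<not> (w i $ 1 < t \<and> t < w j $ 1))) \<and>
              card {l \<in> {..<n}. 0 < e * orient (w i) (w j) (w l)} = K}"
        have "?B = {q \<in> off. w \<in> E e q}"
          using w unfolding off_def E_def close_def R_def by auto
        hence "real (card ?B) = (\<Sum>q\<in>off. indicat_real (E e q) w)"
          using off(1) by (simp add: indicator_def Int_def flip: sum.inter_filter)
        moreover have "card ?A \<le> card ?B + card T * (K + 1)"
          using that by (intro card_pairs_le_strips gp T(1)) auto
        moreover have "card T * (K + 1) \<le> (s - 1) * (K + 1)" using T(2) by (rule mult_right_mono) simp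
        ultimately have "card ?A \<le> card ?B + (s - 1) * (K + 1)"
            and B: "real (card ?B) = (\<Sum>q\<in>off. indicat_real (E e q) w)" by linarith+
        hence "real (card ?A) \<le> real (card ?B + (s - 1) * (K + 1))" by (simp only: of_nat_le_iff)
        thus ?thesis unfolding of_nat_add of_nat_mult B by simp
      qed
      have "card (k_edges k (w ` {..<n})) \<le> (\<Sum>e\<in>{1, -1 :: real}. card {(i, j) \<in> {..<n} \<times> {..<n}. w i $ 1 < w j $ 1 \<and>
              card {l \<in> {..<n}. 0 < e * orient (w i) (w j) (w l)} = K})"
        using xs gp assms(5) K(3) by (rule card_k_edges_le)
      hence "real (card (k_edges k (w ` {..<n}))) \<le>
         real (\<Sum>e\<in>{1, -1 :: real}. card {(i, j) \<in> {..<n} \<times> {..<n}. w i $ 1 < w j $ 1 \<and>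
              card {l \<in> {..<n}. 0 < e * orient (w i) (w j) (w l)} = K})"
        by (simp only: of_nat_le_iff)
      also have "\<dots> \<le> g w" unfolding g_def of_nat_sum using strip by (rule sum_mono)
      finally show ?case .
    qed
  qed
  also have "\<dots> = (\<Sum>e\<in>{1, -1}. (\<Sum>q\<in>off. PI.prob (E e q)) + real (s - 1) * (real K + 1))"
    unfolding g_def using int E(1) by (simp add: PI.prob_space)
  also have "\<dots> \<le> (\<Sum>e\<in>{1, -1 :: real}. real n * real n * (4 / sqrt (real K + 1) * (1 / real s)) + real (s - 1) * (real K + 1))"
  proof (intro sum_mono add_right_mono)
    fix e :: real
    have "(\<Sum>q\<in>off. PI.prob (E e q)) \<le> real (card off) * (4 / sqrt (real K + 1) * (1 / real s))"
      using E(2) by (intro sum_bounded_above) auto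
    also have "\<dots> \<le> real (n * n) * (4 / sqrt (real K + 1) * (1 / real s))"
      using off(2) by (intro mult_right_mono) (simp_all only: of_nat_le_iff, simp)
    finally show "(\<Sum>q\<in>off. PI.prob (E e q)) \<le> real n * real n * (4 / sqrt (real K + 1) * (1 / real s))"
      by (simp only: of_nat_mult)
  qed
  also have "\<dots> = 2 * (real n * real n * (4 / sqrt (real K + 1) * (1 / real s)) + real (s - 1) * (real K + 1))"
    by simp
  also have "\<dots> \<le> 10 * real n * (real k + 1) powr (1 / 4)"
    using optimal_strip_count(2)[OF _ K(1), of n] assms(4) by (simp only: s_def)
  finally show ?thesis .
qed

end
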